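(* For integers $k,n,m\geq 1$, let $s_{k,n,m}$ be the number of parallelogram polycubes of width $k$, height $n$ and depth $m$. Then $$s_{k,n,m}=\frac{nm}{k^2(n+k-1)(m+k-1)}\binom{n+k-1}{k-1}^2\binom{m+k-1}{k-1}^2.$$
   Context: A polycube is a finite set of unit cubes of $\mathbb{Z}^3$ (coordinates $(i,j,k)$), considered up to translation. A plateau is a set of cubes with a single common $i$-coordinate forming a full rectangle $\{(i,j,k): b\le j\le t,\ f\le k\le r\}$ (bottom $b$, top $t$, front $f$, back $r$). A parallelogram polycube of width $k$ is a union of $k$ plateaus $P_1,\dots,P_k$ at consecutive $i$-coordinates $1,\dots,k$ with bottoms $b_\ell$, tops $t_\ell$, fronts $f_\ell$, backs $r_\ell$, such that each of these four sequences is weakly increasing and $b_{\ell+1}\le t_\ell$, $f_{\ell+1}\le r_\ell$ for $1\le\ell\le k-1$. Its width is the number $k$ of plateaus, its height is the number of distinct $j$-coordinates of its cubes (i.e. $t_k-b_1+1$), and its depth is the number of distinct $k$-coordinates of its cubes (i.e. $r_k-f_1+1$). *)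

theory Defs
  imports Complex_Main "HOL-Library.Product_Plus"
begin

type_synonym cube = "int \<times> int \<times> int"

definition translation_rel :: "(cube set \<times> cube set) set" where
  "translation_rel = {(S, T). finite S \<and> finite T \<and> (\<exists>v. T = (+) v ` S)}"

definition polycubes :: "cube set set set" where
  "polycubes = {S. finite S} // translation_rel"

definition plateau :: "int \<Rightarrow> int \<Rightarrow> int \<Rightarrow> int \<Rightarrow> int \<Rightarrow> cube set" where
  "plateau i b t f r = {(i, j, k) | j k. b \<le> j \<and> j \<le> t \<and> f \<le> k \<and> k \<le> r}"

text \<open>The conditions \<open>b l \<le> t l\<close> and \<open>f l \<le> r l\<close> say that the plateaus are nonempty.\<close>

definition is_parallelogram :: "nat \<Rightarrow> cube set \<Rightarrow> bool" where
  "is_parallelogram w S \<longleftrightarrow>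
    (\<exists>b t f r :: nat \<Rightarrow> int.
       (\<forall>l\<in>{1..w}. b l \<le> t l \<and> f l \<le> r l) \<and>
       mono_on {1..w} b \<and> mono_on {1..w} t \<and> mono_on {1..w} f \<and> mono_on {1..w} r \<and>
       (\<forall>l\<in>{1..<w}. b (l + 1) \<le> t l \<and> f (l + 1) \<le> r l) \<and>
       S = (\<Union>l\<in>{1..w}. plateau (int l) (b l) (t l) (f l) (r l)))"

definition height :: "cube set \<Rightarrow> nat" where
  "height S = card {j. \<exists>i k. (i, j, k) \<in> S}"

definition depth :: "cube set \<Rightarrow> nat" where
  "depth S = card {k. \<exists>i j. (i, j, k) \<in> S}"

text \<open>A parallelogram polycube is a translation class having a representative whose plateaus lie
  at the \<open>i\<close>-coordinates \<open>1, \<dots>, w\<close>; height and depth are invariant under translation.\<close>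

definition parallelogram_polycubes :: "nat \<Rightarrow> nat \<Rightarrow> nat \<Rightarrow> cube set set set" where
  "parallelogram_polycubes w n m =
    {C \<in> polycubes. \<exists>S\<in>C. is_parallelogram w S \<and> height S = n \<and> depth S = m}"

end

theory Submission imports Defs begin

text \<open>
  Normalising the translation so that \<open>b 1 = f 1 = 0\<close> makes the four sequences of a parallelogram
  polycube unique, and the conditions on \<open>(b, t)\<close> and on \<open>(f, r)\<close> are independent. Hence the count
  is a product of two numbers of parallelogram polyominoes. Once \<open>b 1 = 0\<close> and \<open>t w = n - 1\<close> are
  fixed, such a polyomino is a pair of weakly increasing sequences \<open>x i = b (i + 2)\<close>,
  \<open>y i = t (i + 1)\<close> of length \<open>w - 1\<close> with \<open>x i \<le> y i\<close>. Summing over the last entries of \<open>x\<close>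
  and \<open>y\<close> shows inductively that such pairs are counted by a 2x2 determinant of binomial
  coefficients, which evaluates to a Narayana number.
\<close>

section \<open>Pairs of monotone sequences and their recursion\<close>

text \<open>The bounds \<open>a\<close> and \<open>c\<close> are separate because the recursion
  turns the last entries of \<open>x\<close> and \<open>y\<close> into new bounds, which differ in
  general. Padding with 0 from \<open>p\<close> on makes each pair of finite sequences a single pair
  of functions.\<close>

definition dominated_pairs :: "nat \<Rightarrow> nat \<Rightarrow> nat \<Rightarrow> ((nat \<Rightarrow> nat) \<times> (nat \<Rightarrow> nat)) set" where
  "dominated_pairs p a c = {(x, y).
     mono_on {..<p} x \<and> mono_on {..<p} y \<and>
     (\<forall>i<p. x i \<le> y i \<and> x i \<le> a \<and> y i \<le> c) \<and> (\<forall>i\<ge>p. x i = 0 \<and> y i = 0)}"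

lemma mono_on_lessThan_Suc_iff:
  "mono_on {..<Suc p} (x :: nat \<Rightarrow> nat) \<longleftrightarrow> mono_on {..<p} x \<and> (\<forall>i<p. x i \<le> x p)"
  by (auto simp: monotone_on_def less_Suc_eq)

lemma dominated_pairs_0: "dominated_pairs 0 a c = {(\<lambda>_. 0, \<lambda>_. 0)}"
  by (auto simp: dominated_pairs_def monotone_on_def)

text \<open>By monotonicity the last entries \<open>a'\<close> and \<open>c'\<close> bound all
  earlier ones, so they serve as the bounds of the truncated pair.\<close>

lemma dominated_pairs_Suc:
  "dominated_pairs (Suc p) a c =
    (\<lambda>((a', c'), (x, y)). (x(p := a'), y(p := c'))) `
      (SIGMA d : (SIGMA a' : {..a}. {a'..c}). dominated_pairs p (fst d) (snd d))"
  (is "?L = ?f ` ?R")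
proof (intro subset_antisym subsetI)
  fix z assume "z \<in> ?L"
  then obtain x y where z: "z = (x, y)" "(x, y) \<in> ?L" by (cases z) auto
  let ?w = "((x p, y p), (x(p := 0), y(p := 0)))"
  have "mono_on {..<p} (x(p := 0)) = mono_on {..<p} x" "mono_on {..<p} (y(p := 0)) = mono_on {..<p} y"
    by (auto simp: monotone_on_def)
  then have "?w \<in> ?R"
    using z(2) by (auto simp: dominated_pairs_def mono_on_lessThan_Suc_iff)
  moreover have "z = ?f ?w" using z by simp
  ultimately show "z \<in> ?f ` ?R" by blast
next
  fix z assume "z \<in> ?f ` ?R"
  then obtain a' c' x y where z: "z = (x(p := a'), y(p := c'))" "a' \<le> a" "a' \<le> c'" "c' \<le> c"
    "(x, y) \<in> dominated_pairs p a' c'" by auto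
  have "mono_on {..<p} (x(p := a')) = mono_on {..<p} x" "mono_on {..<p} (y(p := c')) = mono_on {..<p} y"
    by (auto simp: monotone_on_def)
  then show "z \<in> ?L"
    using z by (fastforce simp: dominated_pairs_def mono_on_lessThan_Suc_iff less_Suc_eq)
qed

lemma finite_dominated_pairs: "finite (dominated_pairs p a c)"
proof (induction p arbitrary: a c)
  case 0
  show ?case by (simp add: dominated_pairs_0)
next
  case (Suc p)
  then show ?case unfolding dominated_pairs_Suc by (intro finite_imageI finite_SigmaI) auto
qed

lemma card_dominated_pairs_Suc:
  "card (dominated_pairs (Suc p) a c) = (\<Sum>a'\<le>a. \<Sum>c'=a'..c. card (dominated_pairs p a' c'))"
proof -
  let ?f = "\<lambda>((a', c'), (x, y)). (x(p := a'), y(p := c')) :: (nat \<Rightarrow> nat) \<times> (nat \<Rightarrow> nat)"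
  let ?D = "SIGMA a' : {..a}. {a'..c}"
  let ?R = "SIGMA d : ?D. dominated_pairs p (fst d) (snd d)"
  have "inj_on ?f ?R"
  proof (rule inj_onI, clarsimp)
    fix a1 c1 x1 y1 a2 c2 x2 y2
    assume "(x1, y1) \<in> dominated_pairs p a1 c1" "(x2, y2) \<in> dominated_pairs p a2 c2"
      and e: "x1(p := a1) = x2(p := a2)" "y1(p := c1) = y2(p := c2)"
    \<comment> \<open>The update at \<open>p\<close> overwrites only the padding value 0, so it can
      be undone.\<close>
    then have "x1 p = 0" "y1 p = 0" "x2 p = 0" "y2 p = 0" by (auto simp: dominated_pairs_def)
    then show "a1 = a2 \<and> c1 = c2 \<and> x1 = x2 \<and> y1 = y2"
      using e by (metis fun_upd_same fun_upd_triv fun_upd_upd)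
  qed
  then have "card (dominated_pairs (Suc p) a c) = card ?R"
    unfolding dominated_pairs_Suc by (rule card_image)
  also have "\<dots> = (\<Sum>d\<in>?D. card (dominated_pairs p (fst d) (snd d)))"
    by (intro card_SigmaI) (auto simp: finite_dominated_pairs)
  also have "\<dots> = (\<Sum>a'\<le>a. \<Sum>c'=a'..c. card (dominated_pairs p a' c'))"
    by (subst sum.Sigma) (auto intro!: sum.cong)
  finally show ?thesis .
qed

section \<open>Evaluation of the determinant\<close>

text \<open>The Lindstroem--Gessel--Viennot determinant. The last factor is \<open>(c + p) choose (p - 1)\<close>,
  written so that it vanishes for \<open>p = 0\<close>.\<close>

definition lgv :: "nat \<Rightarrow> nat \<Rightarrow> nat \<Rightarrow> int" where
  "lgv p a c = int ((a + p) choose p) * int ((c + p) choose p)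
     - int ((a + p) choose Suc p) * int ((c + p) choose Suc c)"

text \<open>The lower boundary terms of the two telescoping sums cancel, because
  \<open>(a + p) choose p = (a + p) choose a\<close>.\<close>

lemma sum_lgv_inner:
  assumes "a \<le> d"
  shows "(\<Sum>c'=a..<d. lgv p a c') =
    int ((a + p) choose p) * int ((d + p) choose Suc p)
     - int ((a + p) choose Suc p) * int ((d + p) choose d)"
  using assms
proof (induction d rule: dec_induct)
  case base
  then show ?case using binomial_symmetric[of p "a + p"] by simp
next
  case (step d)
  then show ?case by (simp add: lgv_def algebra_simps)
qed

text \<open>The inner sum telescopes; the outer sum is then the hockey-stick identity in each of the
  two terms.\<close>

lemma sum_lgv:
  assumes "a \<le> Suc c"
  shows "(\<Sum>a'\<le>a. \<Sum>c'=a'..c. lgv p a' c') = lgv (Suc p) a c"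
proof -
  \<comment> \<open>\<open>X\<close> and \<open>Y\<close> stand for the factors that do not depend
    on \<open>a'\<close>.\<close>
  have *: "(\<Sum>a'\<le>a. int ((a' + p) choose p) * X - int ((a' + p) choose Suc p) * Y) =
      int ((a + Suc p) choose Suc p) * X - int ((a + Suc p) choose Suc (Suc p)) * Y" for X Y
    by (induction a) (simp_all add: algebra_simps)
  have "(\<Sum>a'\<le>a. \<Sum>c'=a'..c. lgv p a' c') =
    (\<Sum>a'\<le>a. int ((a' + p) choose p) * int ((Suc c + p) choose Suc p)
      - int ((a' + p) choose Suc p) * int ((Suc c + p) choose Suc c))"
    unfolding atLeastLessThanSuc_atLeastAtMost[symmetric]
    using assms by (intro sum.cong refl sum_lgv_inner) simp
  then show ?thesis unfolding * by (simp add: lgv_def)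
qed

text \<open>\<open>lgv\<close> satisfies the recursion of the cardinalities. The induction
  hypothesis applies to every summand because \<open>c'\<close> ranges only over values \<ge>
  \<open>a'\<close>.\<close>

lemma card_dominated_pairs:
  assumes "a \<le> c"
  shows "int (card (dominated_pairs p a c)) = lgv p a c"
  using assms
proof (induction p arbitrary: a c)
  case 0
  show ?case by (simp add: dominated_pairs_0 lgv_def)
next
  case (Suc p)
  have "int (card (dominated_pairs (Suc p) a c)) = (\<Sum>a'\<le>a. \<Sum>c'=a'..c. lgv p a' c')"
    using Suc by (simp add: card_dominated_pairs_Suc)
  also have "\<dots> = lgv (Suc p) a c"
    using Suc.prems by (intro sum_lgv) simp
  finally show ?case .
qed

text \<open>Every binomial is a rational multiple of \<open>B\<close>; the determinant then
  collapses by (a + 1)(p + 1) - a p = a + p + 1, which gives a Narayana number.\<close>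

lemma lgv_diagonal:
  "real_of_int (lgv p a a) =
     real (a + 1) / (real (p + 1) * real (a + p + 1)) * (real ((a + p + 1) choose p))\<^sup>2"
proof -
  define B where "B = real ((a + p) choose p)"
  have absorb: "(q + 1) * ((d + q) choose Suc q) = d * ((d + q) choose q)" for d q :: nat
    using binomial_absorption[of q "d + q"] binomial_absorb_comp[of "d + q" q] by simp
  have sym: "(a + p) choose p = (p + a) choose a"
    using binomial_symmetric[of p "a + p"] by (simp add: add.commute)
  have 1: "real (p + 1) * real ((a + p) choose Suc p) = real a * B"
    unfolding B_def of_nat_mult[symmetric] absorb ..
  \<comment> \<open>The absorption identity again, with \<open>a\<close> and \<open>p\<close>
    exchanged by symmetry of the binomial.\<close>
  have 2: "real (a + 1) * real ((a + p) choose Suc a) = real p * B"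
    unfolding B_def of_nat_mult[symmetric] sym absorb[of a p, symmetric] by (simp add: add.commute)
  have "(a + p + 1) choose p = Suc (p + a) choose Suc a"
    using binomial_symmetric[of p "a + p + 1"] by (simp add: add.commute)
  then have 3: "real (a + 1) * real ((a + p + 1) choose p) = real (a + p + 1) * B"
    unfolding B_def of_nat_mult[symmetric] sym
    using Suc_times_binomial_eq[of "p + a" a] by (simp add: add.commute mult.commute)
  have "real (a+1) * real (p+1) * real_of_int (lgv p a a) =
     real (a+1) * real (p+1) * B\<^sup>2 - (real (p + 1) * real ((a + p) choose Suc p)) * (real (a + 1) * real ((a + p) choose Suc a))"
    by (simp add: lgv_def B_def algebra_simps power2_eq_square)
  also have "\<dots> = real (a + p + 1) * B\<^sup>2"
    unfolding 1 2 by (simp add: algebra_simps power2_eq_square)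
  finally have 4: "real_of_int (lgv p a a) = real (a + p + 1) * B\<^sup>2 / (real (a+1) * real (p+1))"
    by (simp only: eq_divide_eq) (simp add: mult.commute)
  have 5: "real ((a + p + 1) choose p) = real (a + p + 1) * B / real (a + 1)"
    using 3 by (simp add: field_simps)
  show ?thesis unfolding 4 5 by (simp add: divide_simps power2_eq_square)
qed

section \<open>Parallelogram polyominoes as interval sequences\<close>

text \<open>One half of the parallelogram condition, used alike for (\<open>b\<close>,
  \<open>t\<close>) and for (\<open>f\<close>, \<open>r\<close>).\<close>

definition profile :: "nat \<Rightarrow> (nat \<Rightarrow> int) \<Rightarrow> (nat \<Rightarrow> int) \<Rightarrow> bool" where
  "profile w b t \<longleftrightarrow> (\<forall>l\<in>{1..w}. b l \<le> t l) \<and> mono_on {1..w} b \<and> mono_on {1..w} t \<and>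
     (\<forall>l\<in>{1..<w}. b (l + 1) \<le> t l)"

text \<open>The default 0 outside \<open>{1..w}\<close> makes equality of functions the same as
  equality of sequences.\<close>

definition normal_profiles :: "nat \<Rightarrow> nat \<Rightarrow> ((nat \<Rightarrow> int) \<times> (nat \<Rightarrow> int)) set" where
  "normal_profiles w n = {(b, t). profile w b t \<and> b 1 = 0 \<and> t w = int n - 1 \<and>
     (\<forall>l. l \<notin> {1..w} \<longrightarrow> b l = 0 \<and> t l = 0)}"

text \<open>Since \<open>b (l + 1) \<le> t l\<close>, consecutive intervals overlap and leave no
  gap.\<close>

lemma profile_Union:
  assumes "profile w b t" "w \<ge> 1"
  shows "(\<Union>l\<in>{1..w}. {b l..t l}) = {b 1..t w}"
  using assms(2,1)
proof (induction w rule: dec_induct)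
  case base
  show ?case by simp
next
  case (step w)
  have p: "profile w b t"
    using step.prems by (auto simp: profile_def monotone_on_def)
  have "b 1 \<le> b (Suc w)" "t w \<le> t (Suc w)" "b (Suc w) \<le> t w"
    using step.prems step.hyps by (auto simp: profile_def monotone_on_def)
  then have "{b 1..t w} \<union> {b (Suc w)..t (Suc w)} = {b 1..t (Suc w)}" by auto
  then show ?case using step.IH[OF p] step.hyps by (simp add: atLeastAtMostSuc_conv Un_commute)
qed

text \<open>With \<open>b 1\<close> and \<open>t (p + 1)\<close> fixed, \<open>p\<close> entries of
  each sequence are free. The index shifts by two and by one turn \<open>x i \<le> y i\<close> into
  the overlap condition between neighbouring intervals.\<close>

lemma bij_betw_dominated_pairs_normal_profiles:
  "bij_betw (\<lambda>(x, y).
      (\<lambda>l. if l \<in> {2..p + 1} then int (x (l - 2)) else 0,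
       \<lambda>l. if l \<in> {1..p} then int (y (l - 1)) else if l = p + 1 then int a else 0))
    (dominated_pairs p a a) (normal_profiles (p + 1) (a + 1))"
    (is "bij_betw ?f ?Q ?N")
proof (rule bij_betw_byWitness[where f' = "\<lambda>(b, t).
      (\<lambda>i. if i < p then nat (b (i + 2)) else 0, \<lambda>i. if i < p then nat (t (i + 1)) else 0)"])
  let ?g = "\<lambda>(b, t). (\<lambda>i. if i < p then nat (b (i + 2)) else 0,
    \<lambda>i. if i < p then nat (t (i + 1)) else 0)"
  have N: "profile (p + 1) b t" "b 1 = 0" "t (p + 1) = int a"
    "\<And>l. l \<notin> {1..p + 1} \<Longrightarrow> b l = 0 \<and> t l = 0"
    if "(b, t) \<in> ?N" for b t
    using that by (auto simp: normal_profiles_def)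
  \<comment> \<open>All entries lie between 0 and \<open>a\<close>, so \<open>nat\<close> loses
    nothing.\<close>
  have bounds: "0 \<le> b l \<and> 0 \<le> t l \<and> b l \<le> int a \<and> t l \<le> int a"
    if "(b, t) \<in> ?N" "l \<in> {1..p + 1}" for b t l
  proof -
    have "b 1 \<le> b l" "t l \<le> t (p + 1)" "b l \<le> t l"
      using N(1)[OF that(1)] that(2) by (auto simp: profile_def monotone_on_def)
    then show ?thesis using N(2,3)[OF that(1)] by auto
  qed
  show "\<forall>z\<in>?Q. ?g (?f z) = z"
    by (auto simp: dominated_pairs_def fun_eq_iff)
  show "\<forall>z\<in>?N. ?f (?g z) = z"
  proof
    fix z assume "z \<in> ?N"
    then obtain b t where z: "z = (b, t)" "(b, t) \<in> ?N" by (cases z) auto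
    note N = N[OF z(2)] bounds[OF z(2)]
    have "(if l \<in> {2..p + 1} then int (if l - 2 < p then nat (b (l - 2 + 2)) else 0) else 0) = b l" for l
    proof (cases "l \<in> {2..p + 1}")
      case True
      then have "l - 2 < p" "l - 2 + 2 = l" by auto
      then show ?thesis using True N(5)[of l] by simp
    next
      case False
      then have "l = 1 \<or> l \<notin> {1..p + 1}" by auto
      then show ?thesis using False N(2) N(4)[of l] by auto
    qed
    moreover have "(if l \<in> {1..p} then int (if l - 1 < p then nat (t (l - 1 + 1)) else 0)
        else if l = p + 1 then int a else 0) = t l" for l
      using N(3) N(4)[of l] N(5)[of l] by auto
    ultimately show "?f (?g z) = z" unfolding z(1) by (simp only: prod.case)
  qed
  show "?f ` ?Q \<subseteq> ?N"
  proof (rule image_subsetI)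
    fix z assume "z \<in> ?Q"
    then obtain x y where z: "z = (x, y)" "(x, y) \<in> ?Q" by (cases z) auto
    from z(2) have m: "\<And>i j. i \<le> j \<Longrightarrow> j < p \<Longrightarrow> x i \<le> x j" "\<And>i j. i \<le> j \<Longrightarrow> j < p \<Longrightarrow> y i \<le> y j"
      and i: "\<And>i. i < p \<Longrightarrow> x i \<le> y i" "\<And>i. i < p \<Longrightarrow> x i \<le> a" "\<And>i. i < p \<Longrightarrow> y i \<le> a"
      by (auto simp: dominated_pairs_def monotone_on_def)
    \<comment> \<open>This is \<open>b l \<le> t l\<close> for the inner indices, obtained through
      \<open>x (l - 1)\<close>.\<close>
    have "x (l - 2) \<le> y (l - 1)" if "2 \<le> l" "l \<le> p" for l
      using m(1)[of "l - 2" "l - 1"] i(1)[of "l - 1"] that by linarith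
    then show "?f z \<in> ?N"
      unfolding z(1) using m i by (auto simp: normal_profiles_def profile_def monotone_on_def)
  qed
  show "?g ` ?N \<subseteq> ?Q"
  proof (rule image_subsetI)
    fix z assume "z \<in> ?N"
    then obtain b t where z: "z = (b, t)" "(b, t) \<in> ?N" by (cases z) auto
    note N = N[OF z(2)] bounds[OF z(2)]
    have m: "\<And>i j. 1 \<le> i \<Longrightarrow> i \<le> j \<Longrightarrow> j \<le> p + 1 \<Longrightarrow> b i \<le> b j \<and> t i \<le> t j"
      and o: "\<And>l. 1 \<le> l \<Longrightarrow> l \<le> p \<Longrightarrow> b (l + 1) \<le> t l"
      using N(1) by (auto simp: profile_def monotone_on_def)
    have "nat (b (i + 2)) \<le> nat (t (i + 1))" "nat (b (i + 2)) \<le> a" "nat (t (i + 1)) \<le> a" if "i < p" for i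
      using o[of "i + 1"] N(5)[of "i + 1"] N(5)[of "i + 2"] that by auto
    then show "?g z \<in> ?Q"
      unfolding z(1) using m by (auto simp: dominated_pairs_def monotone_on_def intro!: nat_mono)
  qed
qed

section \<open>Polycubes built from two profiles\<close>

definition shape :: "nat \<Rightarrow> (nat \<Rightarrow> int) \<times> (nat \<Rightarrow> int) \<Rightarrow> (nat \<Rightarrow> int) \<times> (nat \<Rightarrow> int) \<Rightarrow> cube set" where
  "shape w P Q = (\<Union>l\<in>{1..w}. plateau (int l) (fst P l) (snd P l) (fst Q l) (snd Q l))"

lemma mem_shape_iff:
  "(i, j, k) \<in> shape w (b, t) (f, r) \<longleftrightarrow>
    (\<exists>l\<in>{1..w}. i = int l \<and> j \<in> {b l..t l} \<and> k \<in> {f l..r l})"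
  by (auto simp: shape_def plateau_def)

text \<open>Distinct plateaus have distinct first coordinates, so a slice determines its
  index.\<close>

lemma mem_shape_int_iff:
  "(int l, j, k) \<in> shape w (b, t) (f, r) \<longleftrightarrow>
    l \<in> {1..w} \<and> j \<in> {b l..t l} \<and> k \<in> {f l..r l}"
  by (auto simp: mem_shape_iff)

lemma finite_shape: "finite (shape w P Q)"
proof -
  have "plateau i b t f r = {i} \<times> {b..t} \<times> {f..r}" for i b t f r by (auto simp: plateau_def)
  then show ?thesis by (simp add: shape_def)
qed

lemma is_parallelogram_iff:
  "is_parallelogram w S \<longleftrightarrow>
     (\<exists>b t f r. profile w b t \<and> profile w f r \<and> S = shape w (b, t) (f, r))"
  unfolding is_parallelogram_def profile_def shape_def fst_conv snd_conv
  by (intro arg_cong[where f = Ex] ext) (simp only: ball_conj_distrib conj_ac)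

text \<open>Each plateau is a product of nonempty intervals, so it projects onto its full factors,
  whose union is a single interval.\<close>

lemma shape_projections:
  assumes "profile w b t" "profile w f r" "w \<ge> 1"
  shows "{i. \<exists>j k. (i, j, k) \<in> shape w (b, t) (f, r)} = int ` {1..w}"
    and "{j. \<exists>i k. (i, j, k) \<in> shape w (b, t) (f, r)} = {b 1..t w}"
    and "{k. \<exists>i j. (i, j, k) \<in> shape w (b, t) (f, r)} = {f 1..r w}"
proof -
  have ne: "b l \<in> {b l..t l}" "f l \<in> {f l..r l}" if "l \<in> {1..w}" for l
    using assms that by (auto simp: profile_def)
  show "{i. \<exists>j k. (i, j, k) \<in> shape w (b, t) (f, r)} = int ` {1..w}"
    unfolding mem_shape_iff using ne by blast
  have "{j. \<exists>i k. (i, j, k) \<in> shape w (b, t) (f, r)} = (\<Union>l\<in>{1..w}. {b l..t l})"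
    unfolding mem_shape_iff using ne(2) by blast
  then show "{j. \<exists>i k. (i, j, k) \<in> shape w (b, t) (f, r)} = {b 1..t w}"
    using profile_Union assms by simp
  have "{k. \<exists>i j. (i, j, k) \<in> shape w (b, t) (f, r)} = (\<Union>l\<in>{1..w}. {f l..r l})"
    unfolding mem_shape_iff using ne(1) by blast
  then show "{k. \<exists>i j. (i, j, k) \<in> shape w (b, t) (f, r)} = {f 1..r w}"
    using profile_Union assms by simp
qed

section \<open>Translation classes and their normal representatives\<close>

lemma equiv_translation_rel: "equiv {S. finite S} translation_rel"
proof (rule equivI)
  show "translation_rel \<subseteq> {S. finite S} \<times> {S. finite S}" by (auto simp: translation_rel_def)
  have "(S, S) \<in> translation_rel" if "finite S" for S
    using that image_add_0[of S] unfolding translation_rel_def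
    by (metis (mono_tags, lifting) case_prodI mem_Collect_eq)
  then show "refl_on {S. finite S} translation_rel" by (auto simp: refl_on_def)
  show "sym translation_rel"
  proof (rule symI)
    fix S T assume "(S, T) \<in> translation_rel"
    then obtain v where "finite S" "finite T" "T = (+) v ` S" by (auto simp: translation_rel_def)
    then have "S = (+) (- v) ` T" by (simp add: image_image)
    then show "(T, S) \<in> translation_rel"
      using \<open>finite S\<close> \<open>finite T\<close> by (auto simp only: translation_rel_def)
  qed
  show "trans translation_rel"
  proof (rule transI)
    fix S T U assume "(S, T) \<in> translation_rel" "(T, U) \<in> translation_rel"
    then obtain v w where "finite S" "finite U" "T = (+) v ` S" "U = (+) w ` T"
      by (auto simp: translation_rel_def)
    then have "U = (+) (w + v) ` S" by (simp add: image_image add.assoc)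
    then show "(S, U) \<in> translation_rel"
      using \<open>finite S\<close> \<open>finite U\<close> by (auto simp only: translation_rel_def)
  qed
qed

lemma image_plus_eq_imp_zero:
  fixes c d e :: int
  assumes "(+) c ` {d..e} = {d..e}" "d \<le> e"
  shows "c = 0"
proof -
  have "{c + d..c + e} = {d..e}" using assms(1) by simp
  then show ?thesis using assms(2) by (simp add: Icc_eq_Icc)
qed

text \<open>Both shapes have the same three projections, which are nonempty finite intervals; each
  component of the translation preserves such an interval and hence is 0.\<close>

lemma shape_translation_rel_imp_eq:
  assumes P: "P \<in> normal_profiles w n" "P' \<in> normal_profiles w n"
    and Q: "Q \<in> normal_profiles w m" "Q' \<in> normal_profiles w m"
    and "w \<ge> 1" "n \<ge> 1" "m \<ge> 1"
    and rel: "(shape w P Q, shape w P' Q') \<in> translation_rel"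
  shows "shape w P Q = shape w P' Q'"
proof -
  obtain b t f r b' t' f' r' where e: "P = (b, t)" "Q = (f, r)" "P' = (b', t')" "Q' = (f', r')"
    by (metis surj_pair)
  have p: "profile w b t" "profile w f r" "profile w b' t'" "profile w f' r'"
    and z: "b 1 = 0" "t w = int n - 1" "f 1 = 0" "r w = int m - 1"
      "b' 1 = 0" "t' w = int n - 1" "f' 1 = 0" "r' w = int m - 1"
    using P Q unfolding e by (auto simp: normal_profiles_def)
  let ?S = "shape w P Q" and ?S' = "shape w P' Q'"
  obtain v1 v2 v3 where v: "?S' = (+) (v1, v2, v3) ` ?S"
    using rel by (auto simp: translation_rel_def)
  note pr = shape_projections[OF p(1,2) \<open>w \<ge> 1\<close>, folded e] 
    shape_projections[OF p(3,4) \<open>w \<ge> 1\<close>, folded e]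
  have "{i. \<exists>j k. (i, j, k) \<in> ?S'} = (+) v1 ` {i. \<exists>j k. (i, j, k) \<in> ?S}"
    unfolding v by (force simp: image_iff)
  then have "v1 = 0"
    unfolding pr image_int_atLeastAtMost using \<open>w \<ge> 1\<close> by (intro image_plus_eq_imp_zero) auto
  have "{j. \<exists>i k. (i, j, k) \<in> ?S'} = (+) v2 ` {j. \<exists>i k. (i, j, k) \<in> ?S}"
    unfolding v by (force simp: image_iff)
  then have "v2 = 0"
    unfolding pr z using \<open>n \<ge> 1\<close> by (intro image_plus_eq_imp_zero) auto
  have "{k. \<exists>i j. (i, j, k) \<in> ?S'} = (+) v3 ` {k. \<exists>i j. (i, j, k) \<in> ?S}"
    unfolding v by (force simp: image_iff)
  then have "v3 = 0"
    unfolding pr z using \<open>m \<ge> 1\<close> by (intro image_plus_eq_imp_zero) auto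
  show ?thesis using v unfolding \<open>v1 = 0\<close> \<open>v2 = 0\<close> \<open>v3 = 0\<close> by (simp flip: zero_prod_def)
qed

text \<open>The slice at \<open>l\<close> is a nonempty rectangle, which determines both of its
  sides; outside \<open>{1..w}\<close> all values are 0.\<close>

lemma shape_eq_imp_eq:
  assumes P: "P \<in> normal_profiles w n" "P' \<in> normal_profiles w n"
    and Q: "Q \<in> normal_profiles w m" "Q' \<in> normal_profiles w m"
    and eq: "shape w P Q = shape w P' Q'"
  shows "P = P' \<and> Q = Q'"
proof -
  obtain b t f r b' t' f' r' where e: "P = (b, t)" "Q = (f, r)" "P' = (b', t')" "Q' = (f', r')"
    by (metis surj_pair)
  have "b l = b' l \<and> t l = t' l \<and> f l = f' l \<and> r l = r' l" for l
  proof (cases "l \<in> {1..w}")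
    case True
    have le: "b l \<le> t l" "f l \<le> r l" "b' l \<le> t' l" "f' l \<le> r' l"
      using P Q True unfolding e by (auto simp: normal_profiles_def profile_def)
    have "j \<in> {b l..t l} \<and> k \<in> {f l..r l} \<longleftrightarrow> j \<in> {b' l..t' l} \<and> k \<in> {f' l..r' l}" for j k
      using eq True unfolding e by (metis mem_shape_int_iff)
    then have "{b l..t l} \<times> {f l..r l} = {b' l..t' l} \<times> {f' l..r' l}" by blast
    then show ?thesis using le by (auto simp: times_eq_iff Icc_eq_Icc)
  next
    case False
    then show ?thesis using P Q unfolding e by (auto simp: normal_profiles_def)
  qed
  then show ?thesis unfolding e by auto
qed

lemma translate_profile:
  assumes "profile w b t" "w \<ge> 1" "t w = b 1 + int n - 1"
  shows "(\<lambda>l. if l \<in> {1..w} then b l - b 1 else 0, \<lambda>l. if l \<in> {1..w} then t l - b 1 else 0)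
     \<in> normal_profiles w n"
  using assms by (auto simp: normal_profiles_def profile_def monotone_on_def)

text \<open>Injectivity says that a class contains at most one normalised shape. For surjectivity, a
  representative is translated so that \<open>b 1\<close> and \<open>f 1\<close> become 0.\<close>

lemma bij_betw_polycubes:
  assumes "w \<ge> 1" "n \<ge> 1" "m \<ge> 1"
  shows "bij_betw (\<lambda>(P, Q). translation_rel `` {shape w P Q})
    (normal_profiles w n \<times> normal_profiles w m) (parallelogram_polycubes w n m)"
  unfolding bij_betw_def
proof
  show "inj_on (\<lambda>(P, Q). translation_rel `` {shape w P Q}) (normal_profiles w n \<times> normal_profiles w m)"
  proof (rule inj_onI, clarsimp)
    fix b t f r b' t' f' r'
    assume A: "(b, t) \<in> normal_profiles w n" "(b', t') \<in> normal_profiles w n"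
      "(f, r) \<in> normal_profiles w m" "(f', r') \<in> normal_profiles w m"
      and eq: "translation_rel `` {shape w (b, t) (f, r)} = translation_rel `` {shape w (b', t') (f', r')}"
    from eq have "(shape w (b, t) (f, r), shape w (b', t') (f', r')) \<in> translation_rel"
      using eq_equiv_class_iff[OF equiv_translation_rel] finite_shape by blast
    then show "b = b' \<and> t = t' \<and> f = f' \<and> r = r'"
      using shape_eq_imp_eq[OF A] shape_translation_rel_imp_eq[OF A assms] by simp
  qed
next
  let ?F = "\<lambda>(P, Q). translation_rel `` {shape w P Q}"
  show "?F ` (normal_profiles w n \<times> normal_profiles w m) = parallelogram_polycubes w n m"
  proof (intro subset_antisym subsetI)
    fix C assume "C \<in> ?F ` (normal_profiles w n \<times> normal_profiles w m)"
    then obtain b t f r where A: "(b, t) \<in> normal_profiles w n" "(f, r) \<in> normal_profiles w m"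
      "C = translation_rel `` {shape w (b, t) (f, r)}" by auto
    then have p: "profile w b t" "profile w f r"
      and z: "b 1 = 0" "t w = int n - 1" "f 1 = 0" "r w = int m - 1"
      by (auto simp: normal_profiles_def)
    have "height (shape w (b, t) (f, r)) = n" "depth (shape w (b, t) (f, r)) = m"
      unfolding height_def depth_def shape_projections[OF p \<open>w \<ge> 1\<close>] z by simp_all
    moreover have "is_parallelogram w (shape w (b, t) (f, r))"
      using p is_parallelogram_iff by blast
    moreover have "shape w (b, t) (f, r) \<in> C"
      unfolding A(3) by (intro equiv_class_self[OF equiv_translation_rel]) (simp add: finite_shape)
    moreover have "C \<in> polycubes"
      unfolding A(3) polycubes_def by (intro quotientI) (simp add: finite_shape)
    ultimately show "C \<in> parallelogram_polycubes w n m"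
      unfolding parallelogram_polycubes_def by blast
  next
    fix C assume "C \<in> parallelogram_polycubes w n m"
    then obtain b t f r where C: "C \<in> polycubes" "shape w (b, t) (f, r) \<in> C"
      and p: "profile w b t" "profile w f r"
      and h: "height (shape w (b, t) (f, r)) = n" "depth (shape w (b, t) (f, r)) = m"
      unfolding parallelogram_polycubes_def is_parallelogram_iff by auto
    let ?S = "shape w (b, t) (f, r)"
    let ?N = "\<lambda>b t. (\<lambda>l. if l \<in> {1..w} then b l - b 1 else 0 :: int,
      \<lambda>l. if l \<in> {1..w} then t l - b 1 else 0 :: int)"
    \<comment> \<open>As \<open>n\<close> and \<open>m\<close> are positive, the cardinality of the
      interval determines the difference of its endpoints.\<close>
    have "t w = b 1 + int n - 1" "r w = f 1 + int m - 1"
      using h assms(2,3) unfolding height_def depth_def shape_projections[OF p \<open>w \<ge> 1\<close>] by auto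
    then have N: "?N b t \<in> normal_profiles w n" "?N f r \<in> normal_profiles w m"
      using translate_profile p \<open>w \<ge> 1\<close> by blast+
    \<comment> \<open>The first component is 0 because the plateaus already lie at \<open>1\<close>,
      ..., \<open>w\<close>.\<close>
    have "shape w (?N b t) (?N f r) = (+) (0, - b 1, - f 1) ` ?S"
    proof (intro subset_antisym subsetI)
      fix z assume "z \<in> shape w (?N b t) (?N f r)"
      then obtain i j k where z: "z = (i, j, k)" "(i, j, k) \<in> shape w (?N b t) (?N f r)"
        by (cases z) auto
      then have "(i, j + b 1, k + f 1) \<in> ?S" by (auto simp: mem_shape_iff)
      moreover have "z = (0, - b 1, - f 1) + (i, j + b 1, k + f 1)" using z by simp
      ultimately show "z \<in> (+) (0, - b 1, - f 1) ` ?S" by blast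
    qed (auto simp: mem_shape_iff)
    then have "(?S, shape w (?N b t) (?N f r)) \<in> translation_rel"
      unfolding translation_rel_def using finite_shape by blast
    moreover obtain T where T: "C = translation_rel `` {T}"
      using C(1) unfolding polycubes_def by (rule quotientE)
    then have "C = translation_rel `` {?S}"
      using C(2) equiv_class_eq[OF equiv_translation_rel] by blast
    ultimately have "C = translation_rel `` {shape w (?N b t) (?N f r)}"
      using equiv_class_eq[OF equiv_translation_rel] by simp
    then have "C = ?F (?N b t, ?N f r)" by (simp only: prod.case)
    then show "C \<in> ?F ` (normal_profiles w n \<times> normal_profiles w m)"
      by (rule image_eqI) (intro SigmaI N)
  qed
qed

section \<open>The Narayana count and the product formula\<close>

lemma card_normal_profiles:
  assumes "w \<ge> 1" "n \<ge> 1"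
  shows "real (card (normal_profiles w n)) =
    real n / (real w * (real n + real w - 1)) * (real ((n + w - 1) choose (w - 1)))\<^sup>2"
proof -
  obtain p a where e: "w = p + 1" "n = a + 1"
    using assms by (metis le_add_diff_inverse2)
  have "card (normal_profiles w n) = card (dominated_pairs p a a)"
    unfolding e using bij_betw_same_card[OF bij_betw_dominated_pairs_normal_profiles] by metis
  then have "real (card (normal_profiles w n)) = real_of_int (lgv p a a)"
    using card_dominated_pairs[of a a p] by (metis of_int_of_nat_eq order_refl)
  also have "\<dots> = real n / (real w * (real n + real w - 1)) * (real ((n + w - 1) choose (w - 1)))\<^sup>2"
    unfolding lgv_diagonal e by (simp add: algebra_simps)
  finally show ?thesis .
qed

theorem theorem3:
  fixes k n m :: nat
  assumes "k \<ge> 1" and "n \<ge> 1" and "m \<ge> 1"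
  shows "real (card (parallelogram_polycubes k n m)) =
    (real n * real m) / ((real k)\<^sup>2 * (real n + real k - 1) * (real m + real k - 1))
      * (real ((n + k - 1) choose (k - 1)))\<^sup>2 * (real ((m + k - 1) choose (k - 1)))\<^sup>2"
proof -
  have "card (parallelogram_polycubes k n m) = card (normal_profiles k n) * card (normal_profiles k m)"
    using bij_betw_same_card[OF bij_betw_polycubes[OF assms]] by (simp add: card_cartesian_product)
  then show ?thesis
    using assms by (simp add: card_normal_profiles power2_eq_square ac_simps)
qed

end
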